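(* Let $d,p\in\mathbb{N}$, $a\geq 0$, $\Omega\subset\mathbb{R}^d$ nonempty, and let $X=X_N=\{x_1,\dots,x_N\}\subset\Omega$ be $\mathcal{H}_{a,p}$-unisolvent. Then for all $f\in C(\Omega)$ we have $$\left|(f-I_{X,a,p}f)(x)\right|\leq\left(1+\lambda_{X,a,p}(x)\right)\|f-f_p^\star\|_{L_\infty(\Omega)}+P_{X,a,p}(x)\,\|f_p^\star-I_{X,a,p}f_p^\star\|_{\mathcal{H}_{a,p}},\qquad x\in\Omega,$$ where $f_p^\star\in\mathbb{P}_p^d(\Omega)$ is the uniform best polynomial approximant of $f$, i.e. $\|f-f_p^\star\|_{L_\infty(\Omega)}=\inf_{g\in\mathbb{P}_p^d(\Omega)}\|f-g\|_{L_\infty(\Omega)}$.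
   Context: The polynomial kernel is $k_{a,p}(x,y):=(a+\langle x,y\rangle)^p$, $x,y\in\Omega$, with the Euclidean inner product. $\mathcal{H}_{a,p}=\mathcal{H}_{a,p}(\Omega)$ is its native space, i.e. the unique reproducing kernel Hilbert space of functions on $\Omega$ with reproducing kernel $k_{a,p}$. $\mathbb{P}_p^d(\Omega)$ is the space of real $d$-variate polynomials of total degree at most $p$ over $\Omega$. The set $X$ of $N$ pairwise distinct points is called $\mathcal{H}_{a,p}$-unisolvent if it allows unique interpolation by $k_{a,p}$, i.e. if the kernel matrix $(k_{a,p}(x_i,x_j))_{i,j=1}^N$ is invertible. In this case, with $V_{a,p}(X):=\operatorname{span}\{k_{a,p}(\cdot,x_i):1\le i\le N\}$, $I_{X,a,p}f$ denotes the unique element of $V_{a,p}(X)$ with $I_{X,a,p}f(x_i)=f(x_i)$, $1\le i\le N$. The Lebesgue function is $\lambda_{X,a,p}(x):=\sup_{0\neq g\in V_{a,p}(X)}\frac{|g(x)|}{\max_{1\le i\le N}|g(x_i)|}$, and the power function is $P_{X,a,p}(x):=\sup_{0\neq g\in\mathcal{H}_{a,p}}\frac{|g(x)-I_{X,a,p}g(x)|}{\|g\|_{\mathcal{H}_{a,p}}}$, $x\in\Omega$. $\|g\|_{L_\infty(\Omega)}=\sup_{x\in\Omega}|g(x)|$.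
   Formalization: For a=0 the native space contains only homogeneous polynomials of degree p, so the norm of f_p^* − I f_p^* may be undefined; for a=0 the formal statement additionally assumes that f_p^* lies in the native space H_{0,p}. Nothing is added for a>0. *)

theory Defs
  imports "HOL-Analysis.Analysis"
begin

text \<open>
  Real functions on a set \<open>\<Omega>\<close> are represented by elements of \<open>extensional \<Omega>\<close>, i.e. they are
  \<open>undefined\<close> outside \<open>\<Omega>\<close>; hence equality of representatives is equality on \<open>\<Omega>\<close>.
\<close>

definition rkhs_norm :: "(('a \<Rightarrow> real) \<Rightarrow> ('a \<Rightarrow> real) \<Rightarrow> real) \<Rightarrow> ('a \<Rightarrow> real) \<Rightarrow> real" where
  "rkhs_norm ip g = sqrt (ip g g)"

text \<open>
  \<open>(H, ip)\<close> is a Hilbert space of functions on \<open>\<Omega>\<close> with reproducing kernel \<open>k\<close>. The kernel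
  determines both \<open>H\<close> and the restriction of \<open>ip\<close> to \<open>H\<close>; the values of \<open>ip\<close> outside
  \<open>H\<close> are irrelevant.
\<close>

locale rkhs =
  fixes \<Omega> :: "'a set"
    and k :: "'a \<Rightarrow> 'a \<Rightarrow> real"
    and H :: "('a \<Rightarrow> real) set"
    and ip :: "('a \<Rightarrow> real) \<Rightarrow> ('a \<Rightarrow> real) \<Rightarrow> real"
  assumes extensional: "H \<subseteq> extensional \<Omega>"
    and zero_mem: "(\<lambda>x\<in>\<Omega>. 0) \<in> H"
    and add_mem: "\<lbrakk>f \<in> H; g \<in> H\<rbrakk> \<Longrightarrow> (\<lambda>x\<in>\<Omega>. f x + g x) \<in> H"
    and scale_mem: "f \<in> H \<Longrightarrow> (\<lambda>x\<in>\<Omega>. c * f x) \<in> H"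
    and ip_commute: "\<lbrakk>f \<in> H; g \<in> H\<rbrakk> \<Longrightarrow> ip f g = ip g f"
    and ip_add_left:
      "\<lbrakk>f \<in> H; g \<in> H; h \<in> H\<rbrakk> \<Longrightarrow> ip (\<lambda>x\<in>\<Omega>. f x + g x) h = ip f h + ip g h"
    and ip_scale_left: "\<lbrakk>f \<in> H; g \<in> H\<rbrakk> \<Longrightarrow> ip (\<lambda>x\<in>\<Omega>. c * f x) g = c * ip f g"
    and ip_nonneg: "f \<in> H \<Longrightarrow> 0 \<le> ip f f"
    and ip_eq_zero: "f \<in> H \<Longrightarrow> ip f f = 0 \<longleftrightarrow> f = (\<lambda>x\<in>\<Omega>. 0)"
    and complete:
      "\<lbrakk>\<And>n. F n \<in> H;
        \<And>e. e > 0 \<Longrightarrow> \<exists>M. \<forall>m\<ge>M. \<forall>n\<ge>M. rkhs_norm ip (\<lambda>x\<in>\<Omega>. F m x - F n x) < e\<rbrakk>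
       \<Longrightarrow> \<exists>f\<in>H. (\<lambda>n::nat. rkhs_norm ip (\<lambda>x\<in>\<Omega>. F n x - f x)) \<longlonglongrightarrow> 0"
    and kernel_mem: "y \<in> \<Omega> \<Longrightarrow> (\<lambda>x\<in>\<Omega>. k x y) \<in> H"
    and reproducing: "\<lbrakk>f \<in> H; y \<in> \<Omega>\<rbrakk> \<Longrightarrow> f y = ip f (\<lambda>x\<in>\<Omega>. k x y)"

definition poly_kernel :: "real \<Rightarrow> nat \<Rightarrow> 'a::real_inner \<Rightarrow> 'a \<Rightarrow> real" where
  "poly_kernel a p x y = (a + x \<bullet> y) ^ p"

text \<open>Below, \<open>\<alpha>\<close> ranges over the multi-indices of total degree at most \<open>p\<close>.\<close>

definition polys :: "(real ^ 'd) set \<Rightarrow> nat \<Rightarrow> (real ^ 'd \<Rightarrow> real) set" where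
  "polys \<Omega> p =
     {\<lambda>x\<in>\<Omega>. \<Sum>\<alpha> | (\<Sum>j\<in>UNIV. \<alpha> j) \<le> p. c \<alpha> * (\<Prod>j\<in>UNIV. (x $ j) ^ \<alpha> j)
      | c :: ('d \<Rightarrow> nat) \<Rightarrow> real. True}"

lemma finite_multi_indices: "finite {\<alpha> :: 'd::finite \<Rightarrow> nat. (\<Sum>j\<in>UNIV. \<alpha> j) \<le> p}"
proof (rule finite_subset)
  show "{\<alpha> :: 'd \<Rightarrow> nat. (\<Sum>j\<in>UNIV. \<alpha> j) \<le> p} \<subseteq> PiE UNIV (\<lambda>_. {..p})"
  proof
    fix \<alpha> :: "'d \<Rightarrow> nat"
    assume "\<alpha> \<in> {\<alpha>. (\<Sum>j\<in>UNIV. \<alpha> j) \<le> p}"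
    moreover have "\<alpha> j \<le> (\<Sum>j\<in>UNIV. \<alpha> j)" for j
      by (rule member_le_sum) auto
    ultimately show "\<alpha> \<in> PiE UNIV (\<lambda>_. {..p})"
      by (auto simp: PiE_iff intro: order_trans)
  qed
  show "finite (PiE (UNIV :: 'd set) (\<lambda>_. {..p}))"
    by (rule finite_PiE) auto
qed

text \<open>
  A set of \<open>N\<close> points is given as a family indexed by a finite type with \<open>N\<close> elements.
\<close>

definition unisolvent :: "('a \<Rightarrow> 'a \<Rightarrow> real) \<Rightarrow> ('n::finite \<Rightarrow> 'a) \<Rightarrow> bool" where
  "unisolvent k X \<longleftrightarrow> inj X \<and> invertible (\<chi> i j. k (X i) (X j))"

definition trial_space ::
  "'a set \<Rightarrow> ('a \<Rightarrow> 'a \<Rightarrow> real) \<Rightarrow> ('n::finite \<Rightarrow> 'a) \<Rightarrow> ('a \<Rightarrow> real) set" where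
  "trial_space \<Omega> k X = {\<lambda>x\<in>\<Omega>. \<Sum>i\<in>UNIV. c i * k x (X i) | c :: 'n \<Rightarrow> real. True}"

definition interpolant ::
  "'a set \<Rightarrow> ('a \<Rightarrow> 'a \<Rightarrow> real) \<Rightarrow> ('n::finite \<Rightarrow> 'a) \<Rightarrow> ('a \<Rightarrow> real) \<Rightarrow> 'a \<Rightarrow> real" where
  "interpolant \<Omega> k X f = (THE s. s \<in> trial_space \<Omega> k X \<and> (\<forall>i. s (X i) = f (X i)))"

text \<open>
  Suprema are taken in \<^typ>\<open>ennreal\<close>, so that no boundedness is presupposed. For a unisolvent
  \<open>X\<close> the denominators below are nonzero.
\<close>

definition lebesgue_function ::
  "'a set \<Rightarrow> ('a \<Rightarrow> 'a \<Rightarrow> real) \<Rightarrow> ('n::finite \<Rightarrow> 'a) \<Rightarrow> 'a \<Rightarrow> ennreal" where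
  "lebesgue_function \<Omega> k X x =
     (SUP g \<in> trial_space \<Omega> k X - {\<lambda>x\<in>\<Omega>. 0}. ennreal (\<bar>g x\<bar> / (MAX i. \<bar>g (X i)\<bar>)))"

definition power_function ::
  "'a set \<Rightarrow> ('a \<Rightarrow> 'a \<Rightarrow> real) \<Rightarrow> ('a \<Rightarrow> real) set \<Rightarrow> (('a \<Rightarrow> real) \<Rightarrow> ('a \<Rightarrow> real) \<Rightarrow> real)
     \<Rightarrow> ('n::finite \<Rightarrow> 'a) \<Rightarrow> 'a \<Rightarrow> ennreal" where
  "power_function \<Omega> k H ip X x =
     (SUP g \<in> H - {\<lambda>x\<in>\<Omega>. 0}. ennreal (\<bar>g x - interpolant \<Omega> k X g x\<bar> / rkhs_norm ip g))"

definition sup_norm :: "'a set \<Rightarrow> ('a \<Rightarrow> real) \<Rightarrow> ennreal" where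
  "sup_norm \<Omega> g = (SUP x\<in>\<Omega>. ennreal \<bar>g x\<bar>)"

text \<open>The infimum is infinite if no polynomial is at finite distance from \<open>f\<close>.\<close>

definition best_poly_approx ::
  "(real ^ 'd) set \<Rightarrow> nat \<Rightarrow> (real ^ 'd \<Rightarrow> real) \<Rightarrow> (real ^ 'd \<Rightarrow> real) \<Rightarrow> bool" where
  "best_poly_approx \<Omega> p f q \<longleftrightarrow>
     q \<in> polys \<Omega> p \<and>
     sup_norm \<Omega> (\<lambda>x. f x - q x) = (INF g\<in>polys \<Omega> p. sup_norm \<Omega> (\<lambda>x. f x - g x))"

end

theory Submission
  imports Defs
begin

text \<open>
  Write \<open>I\<close> for interpolation at \<open>X\<close> and \<open>q\<close> for the best approximant. Interpolation is linear, so
  \[ f - I f = (f - q) - I (f - q) + (q - I q). \]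
  At \<open>x\<close> the first term is at most the uniform error. The second is a trial function whose values
  on \<open>X\<close> are at most the uniform error, so the Lebesgue function controls it. The third lies in the
  native space and vanishes on \<open>X\<close>, so it is its own interpolation error and the power function
  controls it.

  The step that needs work is that \<open>q\<close>, hence \<open>q - I q\<close>, lies in the native space at all. For
  \<open>a = 0\<close> this is a hypothesis. For \<open>a > 0\<close>, multiplying out the power writes the kernel as
  \<open>\<Sum>\<^sub>i w\<^sub>i \<phi>\<^sub>i(x) \<phi>\<^sub>i(y)\<close> with positive weights and with every monomial of degree at most \<open>p\<close> among
  the \<open>\<phi>\<^sub>i\<close>. The \<open>\<phi>\<^sub>i\<close> may be linearly dependent on \<open>\<Omega>\<close>, so one cannot solve for them in terms of
  the kernel translates. Instead, write a polynomial as \<open>\<Sum>\<^sub>i w\<^sub>i s\<^sub>i \<phi>\<^sub>i\<close> and project \<open>s\<close>, orthogonally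
  for the weights \<open>w\<^sub>i\<close>, onto the vectors that represent members of the native space in this way
  (\<open>orthogonal_projection_exists\<close>). The residual is orthogonal to the vector \<open>(\<phi>\<^sub>i(y))\<^sub>i\<close> of each
  translate \<open>k(\<cdot>, y)\<close> with \<open>y \<in> \<Omega>\<close>, which means that it represents the zero function on \<open>\<Omega>\<close>
  (\<open>rkhs.feature_combination_mem\<close>).
\<close>

section \<open>Functions in the span of the features of a kernel\<close>

text \<open>
  Induction on the coordinates: the members of \<open>W\<close> that vanish at the new coordinate \<open>j\<close> form a
  subspace of the kind handled by the induction hypothesis, and it has codimension at most one in
  \<open>W\<close>. A single Gram-Schmidt step adds the missing direction. Arguing by coordinates avoids bases
  and dimensions of \<open>W\<close>.
\<close>

lemma orthogonal_projection_exists: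
  fixes w :: "'i \<Rightarrow> real"
  assumes "finite I" and "\<And>i. i \<in> I \<Longrightarrow> 0 < w i"
    and "(\<lambda>i. 0) \<in> W"
    and "\<And>s t. s \<in> W \<Longrightarrow> t \<in> W \<Longrightarrow> (\<lambda>i. s i + t i) \<in> W"
    and "\<And>s b. s \<in> W \<Longrightarrow> (\<lambda>i. b * s i) \<in> W"
  shows "\<exists>c'\<in>W. \<forall>s\<in>W. (\<Sum>i\<in>I. w i * (c i - c' i) * s i) = 0"
  using assms
proof (induction I arbitrary: W c rule: finite_induct)
  case empty
  then show ?case by auto
next
  case (insert j J)
  note W = insert.prems(2-4)
  define B where "B = (\<lambda>s t. \<Sum>i\<in>insert j J. w i * s i * t i)"
  have B_split: "B s t = w j * s j * t j + (\<Sum>i\<in>J. w i * s i * t i)" for s t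
    using insert.hyps by (simp add: B_def)
  have B_lincomb: "B s (\<lambda>i. b * t i + u i) = b * B s t + B s u" for s t u b
    by (simp add: B_def sum.distrib sum_distrib_left algebra_simps)
  define W0 where "W0 = {s\<in>W. s j = 0}"
  have IH: "\<exists>c'\<in>W0. \<forall>s\<in>W0. B (\<lambda>i. c i - c' i) s = 0" for c
  proof -
    have "\<exists>c'\<in>W0. \<forall>s\<in>W0. (\<Sum>i\<in>J. w i * (c i - c' i) * s i) = 0"
      by (rule insert.IH) (use insert.prems in \<open>auto simp: W0_def\<close>)
    then show ?thesis
      by (auto simp: B_split W0_def)
  qed
  obtain c1 where c1: "c1 \<in> W0" "\<And>s. s \<in> W0 \<Longrightarrow> B (\<lambda>i. c i - c1 i) s = 0"
    using IH[of c] by blast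
  show ?case
  proof (cases "\<exists>t\<in>W. t j \<noteq> 0")
    case False
    then have "W0 = W"
      by (auto simp: W0_def)
    then show ?thesis
      using c1 by (auto simp: B_def)
  next
    case True
    then obtain t0 where t0: "t0 \<in> W" "t0 j \<noteq> 0"
      by blast
    \<comment> \<open>\<open>W\<close> is spanned by \<open>W0\<close> and any member that is nonzero at \<open>j\<close>; \<open>e\<close> is such a member
      made orthogonal to \<open>W0\<close>.\<close>
    define t where "t = (\<lambda>i. inverse (t0 j) * t0 i)"
    have t: "t \<in> W" "t j = 1"
      using t0 W(3) by (auto simp: t_def)
    obtain t1 where t1: "t1 \<in> W0" "\<And>s. s \<in> W0 \<Longrightarrow> B (\<lambda>i. t i - t1 i) s = 0"
      using IH[of t] by blast
    define e where "e = (\<lambda>i. t i - t1 i)"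
    have diff: "(\<lambda>i. s i - b * u i) \<in> W" if "s \<in> W" "u \<in> W" for s u b
      using W(2)[OF that(1) W(3)[OF that(2), of "- b"]] by simp
    have e: "e \<in> W" "e j = 1" "\<And>s. s \<in> W0 \<Longrightarrow> B e s = 0"
      using t t1 diff[of t t1 1] by (auto simp: e_def W0_def)
    have "0 \<le> (\<Sum>i\<in>J. w i * e i * e i)"
      using insert.prems(1)
      by (intro sum_nonneg) (simp add: mult.assoc less_imp_le)
    then have Bee: "0 < B e e"
      using insert.prems(1)[of j] e(2) by (simp add: B_split)
    define l where "l = B (\<lambda>i. c i - c1 i) e / B e e"
    define c' where "c' = (\<lambda>i. c1 i + l * e i)"
    have c'_W: "c' \<in> W"
      using diff[of c1 e "- l"] c1(1) e(1) by (simp add: c'_def W0_def)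
    have "B (\<lambda>i. c i - c' i) s = 0" if s: "s \<in> W" for s
    proof -
      define s0 where "s0 = (\<lambda>i. s i - s j * e i)"
      have s0: "s0 \<in> W0"
        using diff[OF s e(1), of "s j"] e(2) by (simp add: s0_def W0_def)
      have c'_B: "B (\<lambda>i. c i - c' i) u = B (\<lambda>i. c i - c1 i) u - l * B e u" for u
        by (simp add: B_def c'_def sum_distrib_left sum_subtractf[symmetric] algebra_simps
            del: sum.insert)
      have "B (\<lambda>i. c i - c' i) s = B (\<lambda>i. c i - c' i) (\<lambda>i. s j * e i + s0 i)"
        by (simp add: s0_def)
      also have "\<dots> = s j * B (\<lambda>i. c i - c' i) e + B (\<lambda>i. c i - c' i) s0"
        by (rule B_lincomb)
      also have "\<dots> = 0"
        using Bee c1(2)[OF s0] e(3)[OF s0] by (simp add: c'_B l_def)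
      finally show ?thesis .
    qed
    then show ?thesis
      using c'_W by (auto simp: B_def)
  qed
qed

context rkhs
begin

lemma sum_mem:
  assumes "finite A" and "\<And>i. i \<in> A \<Longrightarrow> (\<lambda>x\<in>\<Omega>. g i x) \<in> H"
  shows "(\<lambda>x\<in>\<Omega>. \<Sum>i\<in>A. c i * g i x) \<in> H"
  using assms
proof (induction A rule: finite_induct)
  case empty
  then show ?case using zero_mem by (simp add: restrict_def)
next
  case (insert i A)
  have "(\<lambda>x\<in>\<Omega>. (\<lambda>x\<in>\<Omega>. c i * (\<lambda>x\<in>\<Omega>. g i x) x) x + (\<lambda>x\<in>\<Omega>. \<Sum>i\<in>A. c i * g i x) x) \<in> H"
    using insert by (intro add_mem scale_mem) auto
  also have "(\<lambda>x\<in>\<Omega>. (\<lambda>x\<in>\<Omega>. c i * (\<lambda>x\<in>\<Omega>. g i x) x) x + (\<lambda>x\<in>\<Omega>. \<Sum>i\<in>A. c i * g i x) x)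
    = (\<lambda>x\<in>\<Omega>. \<Sum>i\<in>insert i A. c i * g i x)"
    using insert.hyps by (intro restrict_ext) simp
  finally show ?case .
qed

lemma diff_mem:
  assumes "f \<in> H" "g \<in> H"
  shows "(\<lambda>x\<in>\<Omega>. f x - g x) \<in> H"
proof -
  have "(\<lambda>x\<in>\<Omega>. f x + (\<lambda>x\<in>\<Omega>. - 1 * g x) x) \<in> H"
    using assms by (intro add_mem scale_mem)
  also have "(\<lambda>x\<in>\<Omega>. f x + (\<lambda>x\<in>\<Omega>. - 1 * g x) x) = (\<lambda>x\<in>\<Omega>. f x - g x)"
    by (intro restrict_ext) simp
  finally show ?thesis .
qed

text \<open>
  Let a vector \<open>s\<close> represent the function \<open>\<Sum>\<^sub>i w\<^sub>i s\<^sub>i \<phi>\<^sub>i\<close>. Its value at \<open>y \<in> \<Omega>\<close> is the \<open>w\<close>-weighted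
  inner product of \<open>s\<close> with \<open>(\<phi>\<^sub>i(y))\<^sub>i\<close>, and the latter represents \<open>k(\<cdot>, y)\<close>. Hence a vector
  orthogonal to all representatives of members of \<open>H\<close> represents the zero function on \<open>\<Omega>\<close>, and
  subtracting the residual of the projection changes the vector but not the function.
\<close>

lemma feature_combination_mem:
  assumes "finite I" and w: "\<And>i. i \<in> I \<Longrightarrow> 0 < w i"
    and k: "\<And>x y. x \<in> \<Omega> \<Longrightarrow> y \<in> \<Omega> \<Longrightarrow> k x y = (\<Sum>i\<in>I. w i * \<phi> i x * \<phi> i y)"
  shows "(\<lambda>x\<in>\<Omega>. \<Sum>i\<in>I. c i * \<phi> i x) \<in> H"
proof -
  define W where "W = {s. (\<lambda>x\<in>\<Omega>. \<Sum>i\<in>I. w i * s i * \<phi> i x) \<in> H}"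
  \<comment> \<open>Dividing by the weights turns plain coefficients into a representing vector.\<close>
  have "\<exists>c'\<in>W. \<forall>s\<in>W. (\<Sum>i\<in>I. w i * (c i / w i - c' i) * s i) = 0"
  proof (rule orthogonal_projection_exists[OF assms(1) w])
    show "(\<lambda>i. 0) \<in> W"
      using zero_mem by (simp add: W_def)
    show "(\<lambda>i. s i + t i) \<in> W" if "s \<in> W" "t \<in> W" for s t
      using add_mem[of "\<lambda>x\<in>\<Omega>. \<Sum>i\<in>I. w i * s i * \<phi> i x" "\<lambda>x\<in>\<Omega>. \<Sum>i\<in>I. w i * t i * \<phi> i x"] that
      by (simp add: W_def sum.distrib algebra_simps cong: restrict_cong)
    show "(\<lambda>i. b * s i) \<in> W" if "s \<in> W" for s b
      using scale_mem[of "\<lambda>x\<in>\<Omega>. \<Sum>i\<in>I. w i * s i * \<phi> i x" b] that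
      by (simp add: W_def sum_distrib_left algebra_simps cong: restrict_cong)
  qed
  then obtain c' where c': "c' \<in> W"
    and orth: "\<And>s. s \<in> W \<Longrightarrow> (\<Sum>i\<in>I. w i * (c i / w i - c' i) * s i) = 0"
    by blast
  have translate: "(\<lambda>i. \<phi> i y) \<in> W" if "y \<in> \<Omega>" for y
  proof -
    have "(\<lambda>x\<in>\<Omega>. \<Sum>i\<in>I. w i * \<phi> i y * \<phi> i x) = (\<lambda>x\<in>\<Omega>. k x y)"
      using that by (intro restrict_ext) (simp add: k algebra_simps)
    then show ?thesis
      using kernel_mem[OF that] by (simp add: W_def)
  qed
  have "(\<Sum>i\<in>I. c i * \<phi> i x) = (\<Sum>i\<in>I. w i * c' i * \<phi> i x)" if "x \<in> \<Omega>" for x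
  proof -
    have "(\<Sum>i\<in>I. c i * \<phi> i x) - (\<Sum>i\<in>I. w i * c' i * \<phi> i x)
        = (\<Sum>i\<in>I. w i * (c i / w i - c' i) * \<phi> i x)"
      unfolding sum_subtractf[symmetric]
      by (intro sum.cong refl) (use w in \<open>force simp: field_simps\<close>)
    then show ?thesis
      using orth[OF translate[OF that]] by simp
  qed
  then have "(\<lambda>x\<in>\<Omega>. \<Sum>i\<in>I. c i * \<phi> i x) = (\<lambda>x\<in>\<Omega>. \<Sum>i\<in>I. w i * c' i * \<phi> i x)"
    by (intro restrict_ext)
  then show ?thesis
    using c' by (simp add: W_def)
qed

end

section \<open>Polynomials in the native space of the polynomial kernel\<close>

text \<open>
  Monomials of degree at most \<open>p\<close> are indexed by words of length \<open>p\<close> whose letters name either a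
  coordinate or the constant \<open>1\<close>, written \<open>None\<close>. A monomial has many such words, but this
  redundancy lets the power of a sum expand by distributivity, without multinomial coefficients.
\<close>

definition words :: "nat \<Rightarrow> (nat \<Rightarrow> 'd option) set" where
  "words p = PiE {..<p} (\<lambda>_. UNIV)"

definition word_monomial :: "nat \<Rightarrow> (nat \<Rightarrow> 'd option) \<Rightarrow> real ^ 'd::finite \<Rightarrow> real" where
  "word_monomial p u x = (\<Prod>i<p. case u i of None \<Rightarrow> 1 | Some j \<Rightarrow> x $ j)"

lemma finite_words: "finite (words p :: (nat \<Rightarrow> 'd::finite option) set)"
  unfolding words_def by (rule finite_PiE) auto

lemma poly_kernel_expansion:
  fixes x y :: "real ^ 'd"
  shows "poly_kernel a p x y
    = (\<Sum>u\<in>words p. (\<Prod>i<p. case u i of None \<Rightarrow> a | Some j \<Rightarrow> 1)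
        * word_monomial p u x * word_monomial p u y)"
proof -
  have "(a + x \<bullet> y) = (\<Sum>l\<in>UNIV. case l of None \<Rightarrow> a | Some j \<Rightarrow> x $ j * y $ j)"
    by (simp add: UNIV_option_conv sum.reindex inner_vec_def)
  then have "poly_kernel a p x y
      = (\<Prod>i<p. \<Sum>l\<in>UNIV. case l of None \<Rightarrow> a | Some j \<Rightarrow> x $ j * y $ j)"
    by (simp add: poly_kernel_def)
  also have "\<dots> = (\<Sum>u\<in>words p. \<Prod>i<p. case u i of None \<Rightarrow> a | Some j \<Rightarrow> x $ j * y $ j)"
    unfolding words_def by (rule prod_sum_PiE) auto
  also have "\<dots> = (\<Sum>u\<in>words p. (\<Prod>i<p. case u i of None \<Rightarrow> a | Some j \<Rightarrow> 1)
        * word_monomial p u x * word_monomial p u y)"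
    unfolding word_monomial_def prod.distrib[symmetric]
    by (intro sum.cong prod.cong refl) (auto split: option.split)
  finally show ?thesis .
qed

text \<open>Spell out the factors one at a time and pad the word with \<open>None\<close>.\<close>

lemma monomial_as_word:
  fixes \<alpha> :: "'d::finite \<Rightarrow> nat"
  assumes "(\<Sum>j\<in>UNIV. \<alpha> j) \<le> p"
  shows "\<exists>u\<in>words p. \<forall>x. word_monomial p u x = (\<Prod>j\<in>UNIV. (x $ j) ^ \<alpha> j)"
  using assms
proof (induction p arbitrary: \<alpha>)
  case 0
  then show ?case by (simp add: words_def word_monomial_def)
next
  case (Suc p)
  have extend: "u(p := l) \<in> words (Suc p) \<and>
      (\<forall>x. word_monomial (Suc p) (u(p := l)) x
        = word_monomial p u x * (case l of None \<Rightarrow> 1 | Some j \<Rightarrow> x $ j))"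
    if "u \<in> words p" for u :: "nat \<Rightarrow> 'd option" and l
    using that by (auto simp: words_def word_monomial_def PiE_iff extensional_def)
  show ?case
  proof (cases "(\<Sum>j\<in>UNIV. \<alpha> j) \<le> p")
    case True
    then obtain u where "u \<in> words p" "\<forall>x. word_monomial p u x = (\<Prod>j\<in>UNIV. (x $ j) ^ \<alpha> j)"
      using Suc.IH by blast
    then show ?thesis
      using extend[of u None] by auto
  next
    case False
    then have "(\<Sum>j\<in>UNIV. \<alpha> j) \<noteq> 0"
      by linarith
    then obtain j m where j: "\<alpha> j = Suc m"
      by (meson sum.neutral not0_implies_Suc)
    define \<beta> where "\<beta> = \<alpha>(j := m)"
    have "(\<Sum>i\<in>UNIV. \<alpha> i) = Suc (\<Sum>i\<in>UNIV. \<beta> i)"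
      using j by (simp add: \<beta>_def sum.remove[of UNIV j])
    then obtain u where u: "u \<in> words p"
      "\<And>x. word_monomial p u x = (\<Prod>i\<in>UNIV. (x $ i) ^ \<beta> i)"
      using Suc.IH[of \<beta>] Suc.prems by auto
    have "(\<Prod>i\<in>UNIV. (x $ i) ^ \<beta> i) * x $ j = (\<Prod>i\<in>UNIV. (x $ i) ^ \<alpha> i)" for x :: "real ^ 'd"
      using j by (simp add: \<beta>_def prod.remove[of UNIV j])
    then show ?thesis
      using extend[OF u(1), of "Some j"] u(2) by auto
  qed
qed

text \<open>
  Positivity of \<open>a\<close> makes every weight in the expansion positive; for \<open>a = 0\<close> only the homogeneous
  monomials of degree \<open>p\<close> would survive.
\<close>

lemma polys_subset_native_space:
  assumes "0 < a" and "rkhs \<Omega> (poly_kernel a p) H ip"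
  shows "polys \<Omega> p \<subseteq> H"
proof
  interpret rkhs \<Omega> "poly_kernel a p" H ip by fact
  fix q assume "q \<in> polys \<Omega> p"
  then obtain c where
    q: "q = (\<lambda>x\<in>\<Omega>. \<Sum>\<alpha> | (\<Sum>j\<in>UNIV. \<alpha> j) \<le> p. c \<alpha> * (\<Prod>j\<in>UNIV. (x $ j) ^ \<alpha> j))"
    by (auto simp: polys_def)
  show "q \<in> H"
    unfolding q
  proof (rule sum_mem[OF finite_multi_indices])
    fix \<alpha> :: "'a \<Rightarrow> nat"
    assume "\<alpha> \<in> {\<alpha>. (\<Sum>j\<in>UNIV. \<alpha> j) \<le> p}"
    then obtain u where u: "u \<in> words p"
      "\<And>x. word_monomial p u x = (\<Prod>j\<in>UNIV. (x $ j) ^ \<alpha> j)"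
      using monomial_as_word by blast
    have "(\<lambda>x\<in>\<Omega>. \<Sum>u'\<in>words p. (if u' = u then 1 else 0) * word_monomial p u' x) \<in> H"
    proof (rule feature_combination_mem[OF finite_words _ poly_kernel_expansion])
      show "0 < (\<Prod>i<p. case u' i of None \<Rightarrow> a | Some j \<Rightarrow> 1)" for u' :: "nat \<Rightarrow> 'a option"
        using \<open>0 < a\<close> by (intro prod_pos) (auto split: option.split)
    qed
    then show "(\<lambda>x\<in>\<Omega>. \<Prod>j\<in>UNIV. (x $ j) ^ \<alpha> j) \<in> H"
      using u finite_words[where 'd = 'a] by (simp add: if_distrib[of "\<lambda>b. b * _"] cong: if_cong)
  qed
qed

section \<open>Interpolation in the trial space\<close>

lemma trial_space_diff:
  assumes "s \<in> trial_space \<Omega> k X" "t \<in> trial_space \<Omega> k X"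
  shows "(\<lambda>x\<in>\<Omega>. s x - t x) \<in> trial_space \<Omega> k X"
proof -
  obtain c d where "s = (\<lambda>x\<in>\<Omega>. \<Sum>i\<in>UNIV. c i * k x (X i))"
    "t = (\<lambda>x\<in>\<Omega>. \<Sum>i\<in>UNIV. d i * k x (X i))"
    using assms by (auto simp: trial_space_def)
  then have "(\<lambda>x\<in>\<Omega>. s x - t x) = (\<lambda>x\<in>\<Omega>. \<Sum>i\<in>UNIV. (c i - d i) * k x (X i))"
    by (intro restrict_ext) (simp add: sum_subtractf algebra_simps)
  then show ?thesis
    unfolding trial_space_def mem_Collect_eq by (intro exI[of _ "\<lambda>i. c i - d i"]) simp
qed

lemma (in rkhs) trial_space_subset:
  assumes "range X \<subseteq> \<Omega>"
  shows "trial_space \<Omega> k X \<subseteq> H"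
  using assms by (auto simp: trial_space_def intro!: sum_mem kernel_mem)

text \<open>Interpolation conditions are a linear system whose matrix is the kernel matrix.\<close>

lemma trial_space_ex1_interpolant:
  fixes X :: "'n::finite \<Rightarrow> 'a"
  assumes "range X \<subseteq> \<Omega>" and "unisolvent k X"
  shows "\<exists>!s. s \<in> trial_space \<Omega> k X \<and> (\<forall>i. s (X i) = v i)"
proof -
  define A :: "real ^ 'n ^ 'n" where "A = (\<chi> i j. k (X i) (X j))"
  define F where "F c = (\<lambda>x\<in>\<Omega>. \<Sum>i\<in>UNIV. c $ i * k x (X i))" for c :: "real ^ 'n"
  obtain A' where A': "A ** A' = mat 1" "A' ** A = mat 1"
    using assms(2) by (auto simp: unisolvent_def A_def invertible_def)
  have trial: "s \<in> trial_space \<Omega> k X \<longleftrightarrow> (\<exists>c. s = F c)" for s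
  proof
    assume "s \<in> trial_space \<Omega> k X"
    then obtain c where "s = (\<lambda>x\<in>\<Omega>. \<Sum>i\<in>UNIV. c i * k x (X i))"
      by (auto simp: trial_space_def)
    then have "s = F (\<chi> i. c i)"
      by (simp add: F_def)
    then show "\<exists>c. s = F c" by blast
  qed (auto simp: trial_space_def F_def)
  have "F c (X i) = (A *v c) $ i" for c i
    using assms(1) by (auto simp: F_def A_def matrix_vector_mult_def mult.commute)
  then have cond: "(\<forall>i. F c (X i) = v i) \<longleftrightarrow> A *v c = (\<chi> i. v i)" for c
    by (simp add: vec_eq_iff)
  have "A *v (A' *v (\<chi> i. v i)) = (\<chi> i. v i)"
    by (simp add: matrix_vector_mul_assoc A')
  moreover have "c = A' *v (\<chi> i. v i)" if "A *v c = (\<chi> i. v i)" for c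
    using that by (metis A'(2) matrix_vector_mul_assoc matrix_vector_mul_lid)
  ultimately show ?thesis
    using trial cond by metis
qed

context
  fixes \<Omega> :: "'a set" and k :: "'a \<Rightarrow> 'a \<Rightarrow> real" and X :: "'n::finite \<Rightarrow> 'a"
  assumes X: "range X \<subseteq> \<Omega>" and unisolvent: "unisolvent k X"
begin

lemma interpolant:
  shows interpolant_mem: "interpolant \<Omega> k X f \<in> trial_space \<Omega> k X"
    and interpolant_eq: "interpolant \<Omega> k X f (X i) = f (X i)"
  using theI'[OF trial_space_ex1_interpolant[OF X unisolvent, of "\<lambda>i. f (X i)"]]
  by (auto simp: interpolant_def)

lemma interpolant_unique:
  assumes "s \<in> trial_space \<Omega> k X" and "\<And>i. s (X i) = f (X i)"
  shows "interpolant \<Omega> k X f = s"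
  unfolding interpolant_def
  by (rule the1_equality[OF trial_space_ex1_interpolant[OF X unisolvent]]) (use assms in auto)

lemma zero_mem_trial_space: "(\<lambda>x\<in>\<Omega>. 0) \<in> trial_space \<Omega> k X"
  using trial_space_diff[OF interpolant_mem interpolant_mem, of undefined undefined]
  by simp

lemma interpolant_zero:
  assumes "\<And>i. f (X i) = 0"
  shows "interpolant \<Omega> k X f = (\<lambda>x\<in>\<Omega>. 0)"
  by (rule interpolant_unique[OF zero_mem_trial_space]) (use X assms in auto)

lemma interpolant_diff:
  "interpolant \<Omega> k X (\<lambda>x. f x - g x)
    = (\<lambda>x\<in>\<Omega>. interpolant \<Omega> k X f x - interpolant \<Omega> k X g x)"
  by (rule interpolant_unique[OF trial_space_diff[OF interpolant_mem interpolant_mem]])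
    (use X in \<open>auto simp: interpolant_eq\<close>)

text \<open>
  The quotient defining the Lebesgue function bounds \<open>g\<close> only where its denominator is nonzero; by
  unisolvence, that fails only for \<open>g = 0\<close>.
\<close>

lemma lebesgue_function_bound:
  assumes g: "g \<in> trial_space \<Omega> k X" and x: "x \<in> \<Omega>"
  shows "ennreal \<bar>g x\<bar> \<le> lebesgue_function \<Omega> k X x * ennreal (MAX i. \<bar>g (X i)\<bar>)"
proof (cases "g = (\<lambda>x\<in>\<Omega>. 0)")
  case True
  then show ?thesis using x by simp
next
  case False
  let ?m = "MAX i. \<bar>g (X i)\<bar>"
  have le: "\<bar>g (X i)\<bar> \<le> ?m" for i
    by (rule Max_ge) auto
  obtain i where "g (X i) \<noteq> 0"
    using False interpolant_unique[OF g, of g] interpolant_zero[of g] by metis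
  then have m: "0 < ?m"
    using le[of i] by linarith
  have "ennreal \<bar>g x\<bar> = ennreal (\<bar>g x\<bar> / ?m) * ennreal ?m"
    using m by (simp add: ennreal_mult[symmetric])
  also have "ennreal (\<bar>g x\<bar> / ?m) \<le> lebesgue_function \<Omega> k X x"
    unfolding lebesgue_function_def by (rule SUP_upper) (use g False in auto)
  finally show ?thesis
    by (simp add: mult_right_mono)
qed

lemma power_function_bound:
  assumes "rkhs \<Omega> k H ip" and g: "g \<in> H" and x: "x \<in> \<Omega>"
  shows "ennreal \<bar>g x - interpolant \<Omega> k X g x\<bar>
    \<le> power_function \<Omega> k H ip X x * ennreal (rkhs_norm ip g)"
proof (cases "g = (\<lambda>x\<in>\<Omega>. 0)")
  case True
  then have "interpolant \<Omega> k X g = (\<lambda>x\<in>\<Omega>. 0)"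
    using X by (intro interpolant_zero) auto
  then show ?thesis using True x by simp
next
  case False
  interpret rkhs \<Omega> k H ip by fact
  have norm_pos: "0 < rkhs_norm ip g"
    using False g ip_nonneg[OF g] ip_eq_zero[OF g] by (simp add: rkhs_norm_def less_le)
  let ?e = "\<bar>g x - interpolant \<Omega> k X g x\<bar>"
  have "ennreal ?e = ennreal (?e / rkhs_norm ip g) * ennreal (rkhs_norm ip g)"
    using norm_pos by (simp add: ennreal_mult[symmetric])
  also have "ennreal (?e / rkhs_norm ip g) \<le> power_function \<Omega> k H ip X x"
    unfolding power_function_def by (rule SUP_upper) (use g False in auto)
  finally show ?thesis
    by (simp add: mult_right_mono)
qed

text \<open>
  The error of \<open>f\<close> at \<open>x\<close> is that of \<open>f - q\<close> plus that of \<open>q\<close>. Only values matter for the former,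
  so the Lebesgue function suffices for it even though \<open>f\<close> may lie outside the native space. For
  the latter, the power function is applied to \<open>q - I q\<close> instead of \<open>q\<close>: both have the same
  interpolation error, because the interpolant of \<open>q - I q\<close> is zero.
\<close>

lemma interpolation_error_bound:
  assumes "rkhs \<Omega> k H ip" and q: "q \<in> H" and x: "x \<in> \<Omega>"
  shows "ennreal \<bar>f x - interpolant \<Omega> k X f x\<bar>
      \<le> (1 + lebesgue_function \<Omega> k X x) * sup_norm \<Omega> (\<lambda>y. f y - q y)
        + power_function \<Omega> k H ip X x
          * ennreal (rkhs_norm ip (\<lambda>y\<in>\<Omega>. q y - interpolant \<Omega> k X q y))"
proof -
  interpret rkhs \<Omega> k H ip by fact
  let ?I = "interpolant \<Omega> k X"
  let ?g = "?I (\<lambda>y. f y - q y)" and ?h = "\<lambda>y\<in>\<Omega>. q y - ?I q y"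
  let ?E = "sup_norm \<Omega> (\<lambda>y. f y - q y)"
  have E: "ennreal \<bar>f y - q y\<bar> \<le> ?E" if "y \<in> \<Omega>" for y
    unfolding sup_norm_def using that by (rule SUP_upper)
  have "(MAX i. \<bar>?g (X i)\<bar>) \<in> range (\<lambda>i. \<bar>?g (X i)\<bar>)"
    by (rule Max_in) auto
  then have max_le: "ennreal (MAX i. \<bar>?g (X i)\<bar>) \<le> ?E"
    using E X by (fastforce simp only: interpolant_eq image_iff)
  have "ennreal \<bar>?g x\<bar> \<le> lebesgue_function \<Omega> k X x * ennreal (MAX i. \<bar>?g (X i)\<bar>)"
    by (rule lebesgue_function_bound[OF interpolant_mem x])
  also have "\<dots> \<le> lebesgue_function \<Omega> k X x * ?E"
    using max_le by (rule mult_left_mono) simp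
  finally have g: "ennreal \<bar>?g x\<bar> \<le> lebesgue_function \<Omega> k X x * ?E" .
  have "?h \<in> H"
    using q interpolant_mem trial_space_subset[OF X] by (intro diff_mem) auto
  moreover have "?I ?h = (\<lambda>x\<in>\<Omega>. 0)"
    using X by (intro interpolant_zero) (auto simp: interpolant_eq)
  ultimately have h: "ennreal \<bar>?h x\<bar> \<le> power_function \<Omega> k H ip X x * ennreal (rkhs_norm ip ?h)"
    using power_function_bound[OF assms(1), of ?h x] x by simp
  have "\<bar>f x - ?I f x\<bar> \<le> \<bar>f x - q x\<bar> + \<bar>?g x\<bar> + \<bar>?h x\<bar>"
    using x by (simp add: interpolant_diff)
  then have "ennreal \<bar>f x - ?I f x\<bar> \<le> ennreal (\<bar>f x - q x\<bar> + \<bar>?g x\<bar> + \<bar>?h x\<bar>)"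
    by (rule ennreal_leI)
  also have "\<dots> = ennreal \<bar>f x - q x\<bar> + ennreal \<bar>?g x\<bar> + ennreal \<bar>?h x\<bar>"
    by (simp add: ennreal_plus)
  also have "\<dots> \<le> ?E + lebesgue_function \<Omega> k X x * ?E
      + power_function \<Omega> k H ip X x * ennreal (rkhs_norm ip ?h)"
    by (intro add_mono E[OF x] g h)
  finally show ?thesis
    by (simp add: distrib_right)
qed

end

theorem proposition15:
  fixes \<Omega> :: "(real ^ 'd) set" and p :: nat and a :: real
    and X :: "'n::finite \<Rightarrow> real ^ 'd"
    and H :: "(real ^ 'd \<Rightarrow> real) set"
    and ip :: "(real ^ 'd \<Rightarrow> real) \<Rightarrow> (real ^ 'd \<Rightarrow> real) \<Rightarrow> real"
    and f fstar :: "real ^ 'd \<Rightarrow> real" and x :: "real ^ 'd"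
  assumes "a \<ge> 0"
    and "\<Omega> \<noteq> {}"
    and "rkhs \<Omega> (poly_kernel a p) H ip"
    and "range X \<subseteq> \<Omega>"
    and "unisolvent (poly_kernel a p) X"
    and "continuous_on \<Omega> f"
    and "best_poly_approx \<Omega> p f fstar"
    and "a = 0 \<Longrightarrow> fstar \<in> H"
    and "x \<in> \<Omega>"
  shows "ennreal \<bar>f x - interpolant \<Omega> (poly_kernel a p) X f x\<bar>
      \<le> (1 + lebesgue_function \<Omega> (poly_kernel a p) X x) * sup_norm \<Omega> (\<lambda>y. f y - fstar y)
        + power_function \<Omega> (poly_kernel a p) H ip X x
          * ennreal (rkhs_norm ip (\<lambda>y\<in>\<Omega>. fstar y - interpolant \<Omega> (poly_kernel a p) X fstar y))"
proof -
  have "fstar \<in> H"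
  proof (cases "a = 0")
    case True
    then show ?thesis by (rule assms(8))
  next
    case False
    then have "polys \<Omega> p \<subseteq> H"
      using assms(1,3) by (intro polys_subset_native_space) auto
    then show ?thesis
      using assms(7) by (auto simp: best_poly_approx_def)
  qed
  then show ?thesis
    by (rule interpolation_error_bound[OF assms(4,5,3) _ assms(9)])
qed

end
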